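(* Consider a function $h:\mathbb{R}^m\to\mathbb{R}$, a map $c:\mathbb{R}^n\to\mathbb{R}^m$, and a point $\bar x\in\mathbb{R}^n$ such that $c$ is $\mathcal{C}^2$ near $\bar x$ and, with $\bar c:=c(\bar x)$, the constraint qualification $$\mathrm{par}\,\partial h(\bar c)\cap\mathrm{Null}\big(\nabla c(\bar x)^*\big)=\{0\}$$ and the strict criticality condition $$\mathrm{ri}\big(\partial h(\bar c)\big)\cap\mathrm{Null}\big(\nabla c(\bar x)^*\big)\ne\emptyset$$ both hold. Suppose too that $h$ is convex and continuous on $\mathrm{dom}\,h$ near $\bar c$. Suppose in addition that $h$ is partly smooth at $\bar c$ relative to the manifold $\mathcal{M}$. Then if Algorithm ProxDescent (described in the context) generates a sequence $x_r\to\bar x$, with corresponding accepted steps $d_r$, we have that $$c(x_r)+\nabla c(x_r)d_r\in\mathcal{M}$$ for all $r$ sufficiently large.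
   Context: $|\cdot|$ is the Euclidean norm; $B_\epsilon(x)$ is the closed Euclidean ball of radius $\epsilon$ around $x$; the map $c$ is smooth, $\nabla c(x):\mathbb{R}^n\to\mathbb{R}^m$ is its derivative at $x$, $^*$ denotes the adjoint, $\mathrm{Null}$ the null space; $\mathrm{par}\,C$ is the linear subspace parallel to the affine span of $C$; $\mathrm{ri}$ is the relative interior of a convex set; $\mathrm{dom}\,h$ is the set where $h<+\infty$. For convex $h$, $\partial h$ is the usual convex subdifferential. Proximal linearized objective: $h_{x,\mu}(d):=h\big(c(x)+\nabla c(x)d\big)+\frac{\mu}{2}|d|^2$ for $d\in\mathbb{R}^n$. A set $\mathcal{M}\subset\mathbb{R}^m$ is a manifold about $\bar c\in\mathcal{M}$ if there is a map $F:\mathbb{R}^m\to\mathbb{R}^k$ that is $\mathcal{C}^2$ around $\bar c$, with $\nabla F(\bar c)$ surjective, such that points $c$ near $\bar c$ lie in $\mathcal{M}$ iff $F(c)=0$; its normal space is $N_{\mathcal{M}}(\bar c)=\mathrm{Range}(\nabla F(\bar c)^* )$. Given a manifold $\mathcal{M}$ about $\bar c$, $h$ is partly smooth at $\bar c$ relative to $\mathcal{M}$ if $h$ is subdifferentially regular at all points $c\in\mathcal{M}$ near $\bar c$ (automatic for lower semicontinuous convex functions), the dependence of the value $h(c)$ and of the (nonempty) subdifferential $\partial h(c)$ on $c\in\mathcal{M}$ near $\bar c$ are $\mathcal{C}^2$ and continuous (as a set-valued mapping) respectively, and the affine span of $\partial h(\bar c)$ is a translate of $N_{\mathcal{M}}(\bar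 c)$. Algorithm ProxDescent. Fix constants $\tau>1$, $\sigma\in(0,1)$, $\mu_{\min}>0$. Choose $x_0\in\mathbb{R}^n$ and $\mu_0\ge\mu_{\min}$; set $\mu\leftarrow\mu_0$. For $k=0,1,2,\dots$ repeat the following inner iteration until a step is accepted: (1) If $d=0$ is a local minimizer of $h_{x_k,\mu}$, terminate with $\bar x=x_k$. (2) Find a local minimizer $d$ of $h_{x_k,\mu}$ such that $h_{x_k,\mu}(d)<h_{x_k,\mu}(0)$. If no such $d$ exists, set $\mu\leftarrow\tau\mu$ and repeat the inner iteration. (3) Otherwise derive a point $x^+$ from $x_k+d$ (by an efficient projection and/or other enhancements). If $$h(c(x_k))-h(c(x^+))\ge\sigma\big[h(c(x_k))-h(c(x_k)+\nabla c(x_k)d)\big]\quad\text{and}\quad|x^+-(x_k+d)|\le\tfrac12|d|,$$ then accept: set $x_{k+1}\leftarrow x^+$, $d_k\leftarrow d$, $\mu_k\leftarrow\mu$, and $\mu\leftarrow\max(\mu_{\min},\mu/\tau)$. Otherwise set $\mu\leftarrow\tau\mu$ and repeat the inner iteration. Standing assumption on the choice of $x^+$: the efficient projection is used whenever possible. For the present (finite convex) $h$ this means: for each point $\bar x$ around which $c$ is $\mathcal{C}^2$, there are constants $\gamma,\delta>0$ such that whenever $x_k\in B_\delta(\bar x)$, $d\in B_\delta(0)$ and $|h(c(x_k)+\nabla c(x_k)d)-h(c(\bar x))|<\delta$, the point $x^+$ chosen in step (3) satisfies $|x^+-(x_k+d)|\le\gamma|d|^2$ and $h(c(x^+))\le h(c(x_k)+\nabla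 c(x_k)d)+\gamma|d|^2$. *)

theory Defs
  imports "HOL-Analysis.Analysis"
begin

section \<open>Smoothness\<close>

definition C1 :: "('a::euclidean_space \<Rightarrow> 'b::euclidean_space) \<Rightarrow> bool" where
  "C1 f \<longleftrightarrow> (\<exists>f'. (\<forall>x. (f has_derivative blinfun_apply (f' x)) (at x)) \<and> continuous_on UNIV f')"

definition C2_near :: "('a::euclidean_space \<Rightarrow> 'b::euclidean_space) \<Rightarrow> 'a \<Rightarrow> bool" where
  "C2_near f x \<longleftrightarrow>
     (\<exists>U (f' :: 'a \<Rightarrow> 'a \<Rightarrow>\<^sub>L 'b) (f'' :: 'a \<Rightarrow> 'a \<Rightarrow>\<^sub>L 'a \<Rightarrow>\<^sub>L 'b).
        open U \<and> x \<in> U \<and>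
        (\<forall>y\<in>U. (f has_derivative blinfun_apply (f' y)) (at y)) \<and>
        (\<forall>y\<in>U. (f' has_derivative blinfun_apply (f'' y)) (at y)) \<and>
        continuous_on U f'')"

abbreviation grad :: "('a::euclidean_space \<Rightarrow> 'b::euclidean_space) \<Rightarrow> 'a \<Rightarrow> 'a \<Rightarrow> 'b" (\<open>\<nabla>\<close>) where
  "\<nabla> f x \<equiv> frechet_derivative f (at x)"

definition Null :: "('a::euclidean_space \<Rightarrow> 'b::euclidean_space) \<Rightarrow> 'a set" where
  "Null L = {v. L v = 0}"


section \<open>Convex and variational analysis\<close>

definition subdiff :: "('a::euclidean_space \<Rightarrow> real) \<Rightarrow> 'a \<Rightarrow> 'a set" where
  "subdiff h x = {v. \<forall>y. h x + v \<bullet> (y - x) \<le> h y}"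

text \<open>Meaningful for nonempty \<open>C\<close> only; existence and uniqueness of the subspace are
  \<open>affine_parallel_subspace\<close>.\<close>

definition par :: "'a::euclidean_space set \<Rightarrow> 'a set" where
  "par C = (THE L. subspace L \<and> affine_parallel (affine hull C) L)"

text \<open>Regularity is that of Rockafellar and Wets, Variational Analysis: \<open>h\<close> is
  subdifferentially regular at \<open>x\<close> if its epigraph is Clarke regular at \<open>(x, h x)\<close>, that is,
  locally closed there and with equal regular and limiting normal cones.\<close>

definition regular_normal_cone :: "'a::euclidean_space set \<Rightarrow> 'a \<Rightarrow> 'a set" where
  "regular_normal_cone C x =
     {v. \<forall>e>0. \<forall>\<^sub>F y in at x within C. v \<bullet> (y - x) \<le> e * norm (y - x)}"

definition limiting_normal_cone :: "'a::euclidean_space set \<Rightarrow> 'a \<Rightarrow> 'a set" where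
  "limiting_normal_cone C x =
     {v. \<exists>y w. (\<forall>k. y k \<in> C \<and> w k \<in> regular_normal_cone C (y k)) \<and>
               y \<longlonglongrightarrow> x \<and> w \<longlonglongrightarrow> v}"

definition Clarke_regular :: "'a::euclidean_space set \<Rightarrow> 'a \<Rightarrow> bool" where
  "Clarke_regular C x \<longleftrightarrow>
     (\<exists>e>0. closed (C \<inter> cball x e)) \<and> limiting_normal_cone C x = regular_normal_cone C x"

definition subdifferentially_regular :: "('a::euclidean_space \<Rightarrow> real) \<Rightarrow> 'a \<Rightarrow> bool" where
  "subdifferentially_regular h x \<longleftrightarrow> Clarke_regular (epigraph UNIV h) (x, h x)"

text \<open>Continuity of a set-valued map at \<open>a\<close> relative to \<open>M\<close>, in the sense of
  Painleve-Kuratowski: outer and inner semicontinuity.\<close>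

definition set_valued_continuous_at_within ::
    "('a::euclidean_space \<Rightarrow> 'b::euclidean_space set) \<Rightarrow> 'a \<Rightarrow> 'a set \<Rightarrow> bool" where
  "set_valued_continuous_at_within S a M \<longleftrightarrow>
     (\<forall>y v w. (\<forall>k. y k \<in> M) \<and> y \<longlonglongrightarrow> a \<and> (\<forall>k. v k \<in> S (y k)) \<and> v \<longlonglongrightarrow> w \<longrightarrow> w \<in> S a) \<and>
     (\<forall>y w. (\<forall>k. y k \<in> M) \<and> y \<longlonglongrightarrow> a \<and> w \<in> S a \<longrightarrow>
        (\<exists>v. (\<forall>\<^sub>F k in sequentially. v k \<in> S (y k)) \<and> v \<longlonglongrightarrow> w))"


section \<open>Manifolds and partial smoothness\<close>

text \<open>The codomain \<open>\<real>\<^sup>k\<close> of a defining map, with \<open>k\<close> existentially quantified, is represented by a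
  linear subspace \<open>V\<close> of dimension \<open>k\<close> of the ambient space. This loses no generality: surjectivity
  of the derivative forces \<open>k\<close> to be at most the ambient dimension. The case \<open>k = 0\<close> is
  \<open>V = {0}\<close>.\<close>

definition defining_map ::
    "'b::euclidean_space set \<Rightarrow> 'b \<Rightarrow> 'b set \<Rightarrow> ('b \<Rightarrow> 'b) \<Rightarrow> bool" where
  "defining_map M cb V F \<longleftrightarrow>
     subspace V \<and> range F \<subseteq> V \<and> C2_near F cb \<and> range (\<nabla> F cb) = V \<and>
     (\<forall>\<^sub>F y in nhds cb. y \<in> M \<longleftrightarrow> F y = 0)"

definition manifold_about :: "'b::euclidean_space set \<Rightarrow> 'b \<Rightarrow> bool" where
  "manifold_about M cb \<longleftrightarrow> cb \<in> M \<and> (\<exists>V F. defining_map M cb V F)"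

text \<open>The normal space does not depend on the defining map, so an arbitrary one is chosen. The
  adjoint, taken here in the whole ambient space instead of \<open>V\<close>, vanishes on the orthogonal
  complement of \<open>V = range (\<nabla> F cb)\<close>, so its range is that of the adjoint on \<open>V\<close>.\<close>

definition normal_space :: "'b::euclidean_space set \<Rightarrow> 'b \<Rightarrow> 'b set" where
  "normal_space M cb =
     range (adjoint (\<nabla> (SOME F. \<exists>V. defining_map M cb V F) cb))"

text \<open>A function on \<open>M\<close> is \<open>C\<^sup>2\<close> near \<open>cb\<close> if it agrees on \<open>M\<close>, near \<open>cb\<close>, with a function
  \<open>g\<close> that is \<open>C\<^sup>2\<close> in the ambient space. The subdifferential is the convex one, so the notion
  is meant for convex \<open>h\<close>.\<close>

definition partly_smooth :: "('b::euclidean_space \<Rightarrow> real) \<Rightarrow> 'b \<Rightarrow> 'b set \<Rightarrow> bool" where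
  "partly_smooth h cb M \<longleftrightarrow>
     (\<forall>\<^sub>F y in nhds cb. y \<in> M \<longrightarrow> subdifferentially_regular h y) \<and>
     (\<exists>g. C2_near g cb \<and> (\<forall>\<^sub>F y in nhds cb. y \<in> M \<longrightarrow> h y = g y)) \<and>
     (\<forall>\<^sub>F y in nhds cb. y \<in> M \<longrightarrow>
        subdiff h y \<noteq> {} \<and> set_valued_continuous_at_within (subdiff h) y M) \<and>
     affine_parallel (affine hull (subdiff h cb)) (normal_space M cb)"


section \<open>Algorithm ProxDescent\<close>

definition local_minimizer :: "('a::euclidean_space \<Rightarrow> real) \<Rightarrow> 'a \<Rightarrow> bool" where
  "local_minimizer f x \<longleftrightarrow> (\<forall>\<^sub>F y in nhds x. f x \<le> f y)"

definition linearized ::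
    "('b::euclidean_space \<Rightarrow> real) \<Rightarrow> ('a::euclidean_space \<Rightarrow> 'b) \<Rightarrow> 'a \<Rightarrow> 'a \<Rightarrow> real" where
  "linearized h c x d = h (c x + \<nabla> c x d)"

definition prox_linearized ::
    "('b::euclidean_space \<Rightarrow> real) \<Rightarrow> ('a::euclidean_space \<Rightarrow> 'b) \<Rightarrow> 'a \<Rightarrow> real \<Rightarrow> 'a \<Rightarrow> real" where
  "prox_linearized h c x \<mu> d = linearized h c x d + \<mu> / 2 * (norm d)\<^sup>2"

definition descent_step ::
    "('b::euclidean_space \<Rightarrow> real) \<Rightarrow> ('a::euclidean_space \<Rightarrow> 'b) \<Rightarrow> 'a \<Rightarrow> real \<Rightarrow> 'a \<Rightarrow> bool" where
  "descent_step h c x \<mu> d \<longleftrightarrow>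
     local_minimizer (prox_linearized h c x \<mu>) d \<and>
     prox_linearized h c x \<mu> d < prox_linearized h c x \<mu> 0"

definition acceptable ::
    "('b::euclidean_space \<Rightarrow> real) \<Rightarrow> ('a::euclidean_space \<Rightarrow> 'b) \<Rightarrow> real \<Rightarrow> 'a \<Rightarrow> 'a \<Rightarrow> 'a \<Rightarrow> bool" where
  "acceptable h c \<sigma> x d xp \<longleftrightarrow>
     h (c x) - h (c xp) \<ge> \<sigma> * (h (c x) - linearized h c x d) \<and>
     norm (xp - (x + d)) \<le> 1 / 2 * norm d"

text \<open>A nonterminating run, with its rejected trials. For the outer iterate \<open>x k\<close>, the inner
  iterations are numbered \<open>j = 0, \<dots>, J k\<close>, the last one being the accepted one: inner iteration
  \<open>j\<close> uses the prox parameter \<open>\<mu> k j\<close> and, if step (3) is reached, the local minimizer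
  \<open>d k j\<close> and the derived point \<open>xp k j\<close>. The accepted step is \<open>d k (J k)\<close>. If step (2) finds
  no step in inner iteration \<open>j\<close>, the values of \<open>d k j\<close> and \<open>xp k j\<close> are irrelevant.\<close>

definition proxdescent_run ::
    "('b::euclidean_space \<Rightarrow> real) \<Rightarrow> ('a::euclidean_space \<Rightarrow> 'b) \<Rightarrow> real \<Rightarrow> real \<Rightarrow> real \<Rightarrow>
     (nat \<Rightarrow> 'a) \<Rightarrow> (nat \<Rightarrow> nat) \<Rightarrow> (nat \<Rightarrow> nat \<Rightarrow> real) \<Rightarrow> (nat \<Rightarrow> nat \<Rightarrow> 'a) \<Rightarrow> (nat \<Rightarrow> nat \<Rightarrow> 'a) \<Rightarrow> bool"
  where
  "proxdescent_run h c \<tau> \<sigma> \<mu>min x J \<mu> d xp \<longleftrightarrow>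
     \<mu> 0 0 \<ge> \<mu>min \<and>
     (\<forall>k. \<forall>j\<le>J k. \<not> local_minimizer (prox_linearized h c (x k) (\<mu> k j)) 0) \<and>
     (\<forall>k. \<forall>j<J k.
        ((\<nexists>d'. descent_step h c (x k) (\<mu> k j) d') \<or>
         descent_step h c (x k) (\<mu> k j) (d k j) \<and> \<not> acceptable h c \<sigma> (x k) (d k j) (xp k j)) \<and>
        \<mu> k (Suc j) = \<tau> * \<mu> k j) \<and>
     (\<forall>k. descent_step h c (x k) (\<mu> k (J k)) (d k (J k)) \<and>
          acceptable h c \<sigma> (x k) (d k (J k)) (xp k (J k)) \<and>
          x (Suc k) = xp k (J k) \<and>
          \<mu> (Suc k) 0 = max \<mu>min (\<mu> k (J k) / \<tau>))"

text \<open>The efficient projection is used whenever possible: the condition on \<open>xp k j\<close> concerns every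
  trial that reaches step (3), whether or not it is accepted.\<close>

definition efficient_projection ::
    "('b::euclidean_space \<Rightarrow> real) \<Rightarrow> ('a::euclidean_space \<Rightarrow> 'b) \<Rightarrow>
     (nat \<Rightarrow> 'a) \<Rightarrow> (nat \<Rightarrow> nat) \<Rightarrow> (nat \<Rightarrow> nat \<Rightarrow> real) \<Rightarrow> (nat \<Rightarrow> nat \<Rightarrow> 'a) \<Rightarrow> (nat \<Rightarrow> nat \<Rightarrow> 'a) \<Rightarrow> bool"
  where
  "efficient_projection h c x J \<mu> d xp \<longleftrightarrow>
     (\<forall>z. C2_near c z \<longrightarrow>
        (\<exists>\<gamma>>0. \<exists>\<delta>>0. \<forall>k. \<forall>j\<le>J k.
           descent_step h c (x k) (\<mu> k j) (d k j) \<and>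
           x k \<in> cball z \<delta> \<and> d k j \<in> cball 0 \<delta> \<and>
           \<bar>linearized h c (x k) (d k j) - h (c z)\<bar> < \<delta> \<longrightarrow>
           norm (xp k j - (x k + d k j)) \<le> \<gamma> * (norm (d k j))\<^sup>2 \<and>
           h (c (xp k j)) \<le> linearized h c (x k) (d k j) + \<gamma> * (norm (d k j))\<^sup>2))"

end

theory Submission
  imports Defs
begin

text \<open>Optimality of an accepted step \<open>d\<close> gives a subgradient \<open>v\<close> of \<open>h\<close> at \<open>c x + \<nabla> c x d\<close> whose
  image under the adjoint of \<open>\<nabla> c x\<close> is \<open>- \<mu> d\<close>. Acceptance bounds \<open>d\<close> by twice the move of the
  iterates, so \<open>d\<close> tends to 0. The prox parameters stay bounded, because near the limit every
  trial with large \<open>\<mu>\<close> is short and the quadratic error of the efficient projection is then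
  dominated by the predicted decrease. Hence \<open>\<mu> d\<close> tends to 0, and the constraint qualification
  forces \<open>v\<close> to converge to the unique multiplier, which lies in the relative interior of the
  subdifferential. Partial smoothness and monotonicity of the subdifferential then identify the
  manifold.\<close>

section \<open>Subgradients of finite convex functions\<close>

text \<open>Hahn-Banach: the subspace \<open>S\<close> of pairs \<open>(L e, g \<bullet> e)\<close>
  is separated from the strict epigraph \<open>T\<close> of \<open>h\<close>, translated so that
  \<open>(y, h y)\<close> becomes the origin; \<open>le\<close> makes them disjoint. The slope of a
  non-vertical separating hyperplane is the required subgradient.\<close>

lemma subgradient_chain:
  fixes h :: "'b::euclidean_space \<Rightarrow> real" and L :: "'a::euclidean_space \<Rightarrow> 'b"
  assumes h: "convex_on UNIV h" and L: "linear L"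
    and le: "\<And>e. h y + g \<bullet> e \<le> h (y + L e)"
  shows "\<exists>v\<in>subdiff h y. adjoint L v = g"
proof -
  define S where "S = range (\<lambda>e. (L e, g \<bullet> e))"
  define T where "T = {(z, t). h (y + z) - h y < t}"
  interpret L: linear L by fact
  have "linear (\<lambda>e. (L e, g \<bullet> e))"
    by (auto intro!: linearI simp: L.add L.scale inner_add_right)
  then have S: "convex S"
    unfolding S_def by (simp add: convex_linear_image)
  have T: "convex T"
  proof (rule convexI)
    fix p q :: "'b \<times> real" and u w :: real
    assume pq: "p \<in> T" "q \<in> T" and uw: "0 \<le> u" "0 \<le> w" "u + w = 1"
    obtain z t z' t' where p: "p = (z, t)" and q: "q = (z', t')"
      by (cases p, cases q) auto
    have lt: "h (y + z) - h y < t" "h (y + z') - h y < t'"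
      using pq by (auto simp: T_def p q)
    have "h (u *\<^sub>R (y + z) + w *\<^sub>R (y + z')) \<le> u * h (y + z) + w * h (y + z')"
      using h uw by (auto simp: convex_on_def)
    moreover have "u *\<^sub>R (y + z) + w *\<^sub>R (y + z') = y + (u *\<^sub>R z + w *\<^sub>R z')"
    proof -
      have "u *\<^sub>R y + w *\<^sub>R y = y"
        using uw by (metis scaleR_add_left scaleR_one)
      then show ?thesis by (simp add: algebra_simps)
    qed
    ultimately have "h (y + (u *\<^sub>R z + w *\<^sub>R z')) \<le> u * h (y + z) + w * h (y + z')" by simp
    \<comment> \<open>Strictness survives only through a positive weight; if \<open>u = 0\<close>,
      then \<open>w = 1\<close> supplies it.\<close>
    moreover have "u * (h (y + z) - h y) + w * (h (y + z') - h y) < u * t + w * t'"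
    proof (cases "u = 0")
      case True
      then show ?thesis using uw lt by simp
    next
      case False
      then have "u * (h (y + z) - h y) < u * t"
        using uw lt by simp
      moreover have "w * (h (y + z') - h y) \<le> w * t'"
        using uw lt by (simp add: mult_left_mono)
      ultimately show ?thesis by simp
    qed
    moreover have "u * h y + w * h y = h y"
      using uw by (metis distrib_right mult_1)
    ultimately show "u *\<^sub>R p + w *\<^sub>R q \<in> T"
      by (simp add: T_def p q algebra_simps)
  qed
  have "S \<inter> T = {}"
    using le by (auto simp: S_def T_def) (smt (verit))
  moreover have "S \<noteq> {}" "(0, 1) \<in> T"
    by (auto simp: S_def T_def)
  ultimately obtain a b where a0: "a \<noteq> 0"
    and aS: "\<And>p. p \<in> S \<Longrightarrow> a \<bullet> p \<le> b" and aT: "\<And>p. p \<in> T \<Longrightarrow> b \<le> a \<bullet> p"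
    using separating_hyperplane_sets[OF S T] by blast
  obtain p q where a: "a = (p, q)" by (cases a)
  have aS': "p \<bullet> L e + q * (g \<bullet> e) \<le> b" for e
    using aS[of "(L e, g \<bullet> e)"] by (simp add: a S_def)
  have aT': "b \<le> p \<bullet> z + q * t" if "h (y + z) - h y < t" for z t
    using aT[of "(z, t)"] that by (simp add: a T_def)
  have b0: "0 \<le> b"
    using aS'[of 0] by (simp add: L.zero)
  \<comment> \<open>The hyperplane is not vertical: \<open>q < 0\<close> fails at
    \<open>(0, 1)\<close>, and if \<open>q = 0\<close>, finiteness of \<open>h\<close> everywhere
    permits the test at \<open>z = - p\<close>, which forces \<open>p = 0\<close>.\<close>
  have q0: "0 < q"
  proof (rule ccontr)
    assume "\<not> 0 < q"
    then consider "q < 0" | "q = 0" by linarith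
    then show False
    proof cases
      case 1
      then show False using aT'[of 0 1] b0 by simp
    next
      case 2
      have "b \<le> p \<bullet> (- p)"
        using aT'[of "- p" "h (y - p) - h y + 1"] 2 by simp
      then have "p \<bullet> p \<le> 0" using b0 by simp
      then have "p = 0" using inner_gt_zero_iff not_le by blast
      then show False using a0 2 by (simp add: a zero_prod_def)
    qed
  qed
  have subg: "b \<le> p \<bullet> z + q * (h (y + z) - h y)" for z
  proof (rule field_le_epsilon)
    fix e :: real assume "0 < e"
    then show "b \<le> p \<bullet> z + q * (h (y + z) - h y) + e"
      using aT'[of z "h (y + z) - h y + e / q"] q0
      by (simp add: distrib_left [of q "h (y + z) - h y"])
  qed
  have bz: "b = 0"
    using subg[of 0] b0 by simp
  \<comment> \<open>\<open>S\<close> is symmetric, so its one-sided bound with \<open>b = 0\<close>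
    is an equality.\<close>
  have eq: "p \<bullet> L e + q * (g \<bullet> e) = 0" for e
    using aS'[of e] aS'[of "- e"] bz by (simp add: L.neg)
  define v where "v = - (1 / q) *\<^sub>R p"
  have "v \<in> subdiff h y"
    unfolding subdiff_def
  proof (intro CollectI allI)
    fix z
    show "h y + v \<bullet> (z - y) \<le> h z"
      using subg[of "z - y"] q0 bz by (simp add: v_def field_simps)
  qed
  moreover have "adjoint L v = g"
  proof (rule vector_eq_rdot[THEN iffD1], rule allI)
    fix e
    have "adjoint L v \<bullet> e = v \<bullet> L e"
      by (metis L inner_commute adjoint_works)
    also have "\<dots> = g \<bullet> e"
      using eq[of e] q0 by (simp add: v_def field_simps)
    finally show "adjoint L v \<bullet> e = g \<bullet> e" .
  qed
  ultimately show ?thesis by blast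
qed

text \<open>The chain rule for the zero map and \<open>g = 0\<close>, where its inequality is
  trivial.\<close>

lemma subdiff_nonempty:
  assumes "convex_on UNIV h"
  shows "subdiff h y \<noteq> {}"
  using subgradient_chain[OF assms module_hom_zero, of y 0] by auto

lemma subdiff_monotone:
  assumes "v \<in> subdiff h y" "w \<in> subdiff h z"
  shows "0 \<le> (v - w) \<bullet> (y - z)"
  using assms(2)[unfolded subdiff_def, simplified, rule_format, of y]
    assms(1)[unfolded subdiff_def, simplified, rule_format, of z]
  by (simp add: inner_diff_left inner_diff_right)

lemma convex_on_UNIV_isCont:
  fixes h :: "'b::euclidean_space \<Rightarrow> real"
  assumes "convex_on UNIV h"
  shows "isCont h y"
  using convex_on_continuous[OF open_UNIV assms] by (simp add: continuous_on_eq_continuous_at)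

text \<open>Testing the subgradient inequality at the unit step \<open>y + sgn v\<close> gives
  \<open>norm v \<le> h (y + sgn v) - h y\<close>, which continuity bounds on a ball of radius one
  larger.\<close>

lemma subdiff_bounded_on_bounded:
  fixes h :: "'b::euclidean_space \<Rightarrow> real"
  assumes h: "convex_on UNIV h" and S: "bounded S"
  shows "\<exists>W. \<forall>y\<in>S. \<forall>v\<in>subdiff h y. norm v \<le> W"
proof -
  obtain r where r: "\<And>y. y \<in> S \<Longrightarrow> norm y \<le> r"
    using S bounded_iff by blast
  have "continuous_on (cball 0 (r + 1)) h"
    using h continuous_on_subset convex_on_continuous open_UNIV by blast
  then have "bounded (h ` cball 0 (r + 1))"
    by (simp add: compact_continuous_image compact_imp_bounded)
  then obtain B where B: "\<And>y. norm y \<le> r + 1 \<Longrightarrow> \<bar>h y\<bar> \<le> B"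
    unfolding bounded_iff by (metis imageI mem_cball_0 real_norm_def)
  have "norm v \<le> 2 * B" if "y \<in> S" "v \<in> subdiff h y" for y v
  proof -
    have "h y + v \<bullet> sgn v \<le> h (y + sgn v)"
      using that(2) unfolding subdiff_def by (metis (mono_tags, lifting) add_diff_cancel_left' mem_Collect_eq)
    moreover have "v \<bullet> sgn v = norm v"
      by (cases "v = 0") (auto simp: sgn_div_norm power2_norm_eq_inner[symmetric] power2_eq_square)
    moreover have "norm (sgn v) \<le> 1"
      by (simp add: norm_sgn)
    then have "norm (y + sgn v) \<le> r + 1"
      using r[OF that(1)] norm_triangle_ineq[of y "sgn v"] by linarith
    then have "\<bar>h (y + sgn v)\<bar> \<le> B" by (rule B)
    moreover have "\<bar>h y\<bar> \<le> B"
      using r[OF that(1)] by (intro B) simp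
    ultimately show ?thesis by linarith
  qed
  then show ?thesis by blast
qed

lemma subdiff_limit:
  fixes h :: "'b::euclidean_space \<Rightarrow> real"
  assumes h: "convex_on UNIV h" and "\<And>k. v k \<in> subdiff h (y k)"
    and y: "y \<longlonglongrightarrow> z" and v: "v \<longlonglongrightarrow> w"
  shows "w \<in> subdiff h z"
  unfolding subdiff_def
proof (intro CollectI allI)
  fix u
  have "(\<lambda>k. h (y k) + v k \<bullet> (u - y k)) \<longlonglongrightarrow> h z + w \<bullet> (u - z)"
    by (intro tendsto_intros isCont_tendsto_compose[OF convex_on_UNIV_isCont[OF h]] y v)
  then show "h z + w \<bullet> (u - z) \<le> h u"
    by (rule LIMSEQ_le_const2) (use assms(2) in \<open>auto simp: subdiff_def\<close>)
qed

section \<open>Identification of the manifold\<close>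

text \<open>The map \<open>A\<^sup>* \<circ> F\<close>, with \<open>A\<close> the derivative of \<open>F\<close>, becomes a local open map once a map \<open>P\<close>
  onto \<open>Null A\<close> is added. Solving for an unchanged \<open>P\<close>-component then yields a zero of \<open>F\<close>
  displaced exactly along the normal space.\<close>

lemma manifold_point_along_normal_space:
  fixes M :: "'b::euclidean_space set"
  assumes F: "defining_map M cb V F" and cb: "cb \<in> M" and e: "0 < e"
  shows "\<forall>\<^sub>F z in nhds cb. \<exists>p\<in>M. dist p cb < e \<and> z - p \<in> range (adjoint (\<nabla> F cb))"
proof -
  have F2: "C2_near F cb" and FV: "range F \<subseteq> V" and V: "range (\<nabla> F cb) = V"
    and ev: "\<forall>\<^sub>F y in nhds cb. y \<in> M \<longleftrightarrow> F y = 0"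
    using F by (auto simp: defining_map_def)
  obtain U F' where U: "open U" "cb \<in> U"
    and dF: "\<And>y. y \<in> U \<Longrightarrow> (F has_derivative blinfun_apply (F' y)) (at y)"
    using F2 unfolding C2_near_def by metis
  obtain U' where U': "open U'" "cb \<in> U'" and UM: "\<And>y. y \<in> U' \<Longrightarrow> y \<in> M \<longleftrightarrow> F y = 0"
    using ev unfolding eventually_nhds by blast
  define A where "A = \<nabla> F cb"
  have dA: "(F has_derivative A) (at cb)"
    using dF[OF U(2)] frechet_derivative_at[OF dF[OF U(2)]] by (simp add: A_def)
  interpret A: linear A
    using dA has_derivative_linear by blast
  have linA: "linear A" by (rule A.linear_axioms)
  let ?A' = "adjoint A"
  interpret A': linear ?A' by (rule adjoint_linear[OF linA])
  have adj: "x \<bullet> ?A' y = A x \<bullet> y" for x y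
    by (rule adjoint_works[OF linA])
  have A'0: "w = 0" if "w \<in> range A" "?A' w = 0" for w
  proof -
    obtain u where "w = A u" using \<open>w \<in> range A\<close> by blast
    then have "w \<bullet> w = u \<bullet> ?A' w" by (simp add: adj)
    then show ?thesis using that(2) by simp
  qed
  have N: "subspace {x. A x = 0}"
    by (rule linear_subspace_kernel[OF linA])
  obtain B where B: "finite B" "B \<subseteq> {x. A x = 0}" "span B = {x. A x = 0}"
    by (metis N basis_exists finiteI_independent span_subspace)
  \<comment> \<open>\<open>B\<close> need not be orthonormal, so \<open>P\<close> is no projection
    in general, but \<open>x \<bullet> P x\<close> is the sum of the squares
    \<open>(x \<bullet> b)\<^sup>2\<close>. Hence the kernel of \<open>P\<close> is the orthogonal
    complement of the kernel of \<open>A\<close>.\<close>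
  define P where "P x = (\<Sum>b\<in>B. (x \<bullet> b) *\<^sub>R b)" for x
  have linP: "linear P"
    unfolding P_def
    by (auto intro!: linearI simp: inner_add_left scaleR_left_distrib sum.distrib scaleR_right.sum)
  interpret P: linear P by (rule linP)
  have AP: "A (P x) = 0" for x
    using B by (auto simp: P_def A.sum A.scale intro!: sum.neutral)
  have P0: "x \<bullet> n = 0" if "P x = 0" "A n = 0" for x n
  proof -
    have "0 = x \<bullet> P x" using that by simp
    also have "\<dots> = (\<Sum>b\<in>B. (x \<bullet> b)\<^sup>2)"
      by (simp add: P_def inner_sum_right power2_eq_square)
    finally have "\<forall>b\<in>B. x \<bullet> b = 0"
      using sum_nonneg_eq_0_iff[OF B(1), of "\<lambda>b. (x \<bullet> b)\<^sup>2"] by simp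
    moreover have "n \<in> span B" using that B by simp
    ultimately show ?thesis
      using orthogonal_to_span[of n B x] by (auto simp: orthogonal_def)
  qed
  \<comment> \<open>The component \<open>z\<close> of \<open>x\<close> orthogonal to the range of
    the adjoint lies in the kernel of \<open>A\<close>, to which \<open>x\<close> is orthogonal; so
    \<open>z = 0\<close>.\<close>
  have normal: "x \<in> range ?A'" if "P x = 0" for x
  proof -
    obtain y z where yz: "y \<in> span (range ?A')"
        "\<And>w. w \<in> span (range ?A') \<Longrightarrow> orthogonal z w" "x = y + z"
      using orthogonal_subspace_decomp_exists[of "range ?A'" x] by blast
    have sp: "span (range ?A') = range ?A'"
      by (metis A'.linear_axioms linear_subspace_image span_eq_iff subspace_UNIV)
    have "A z \<bullet> A z = z \<bullet> ?A' (A z)" by (simp add: adj)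
    also have "\<dots> = 0" using yz(2) by (simp add: orthogonal_def span_base)
    finally have "A z = 0" by simp
    then have "x \<bullet> z = 0" using that P0 by blast
    moreover have "y \<bullet> z = 0" using yz by (metis inner_commute orthogonal_def)
    ultimately have "z \<bullet> z = 0" using yz(3) by (simp add: inner_add_left)
    then show ?thesis using yz sp by simp
  qed
  define G where "G y = ?A' (F y) + P (y - cb)" for y
  define G' where "G' y = ?A' (A y) + P y" for y
  have linG': "linear G'"
    unfolding G'_def
    by (auto intro!: linearI simp: A.add A'.add P.add A.scale A'.scale P.scale algebra_simps)
  interpret G': linear G' by (rule linG')
  have "inj G'"
  proof (rule linear_injective_0[THEN iffD2, OF linG'], intro allI impI)
    fix x assume "G' x = 0"
    then have "0 = x \<bullet> G' x" by simp
    also have "\<dots> = A x \<bullet> A x + (\<Sum>b\<in>B. (x \<bullet> b)\<^sup>2)"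
      by (simp add: G'_def inner_add_right adj P_def inner_sum_right power2_eq_square)
    finally have "A x \<bullet> A x = 0"
      by (smt (verit) inner_ge_zero sum_nonneg zero_le_power2)
    then have "A x = 0" by simp
    then have "P x = 0" using \<open>G' x = 0\<close> by (simp add: G'_def A'.zero)
    then have "x \<bullet> x = 0" using \<open>A x = 0\<close> P0 by blast
    then show "x = 0" by simp
  qed
  then obtain g where g: "linear g" "G' \<circ> g = id"
    using linear_surjective_right_inverse linear_injective_imp_surjective linG' by blast
  have dG: "(G has_derivative G') (at cb)"
    unfolding G_def G'_def
    by (rule derivative_eq_intros bounded_linear.has_derivative[OF linear_conv_bounded_linear[THEN iffD1]]
        A'.linear_axioms linP dA refl | simp)+
  have contF: "continuous_on U F"
    using dF by (meson continuous_at_imp_continuous_on has_derivative_continuous)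
  have contG: "continuous_on U G"
    unfolding G_def
    by (intro continuous_intros contF linear_continuous_on_compose[OF _ A'.linear_axioms]
        linear_continuous_on_compose[OF _ linP])
  define T where "T = U \<inter> U' \<inter> ball cb e"
  have "cb \<in> interior T"
    using U U' e by (simp add: T_def interior_open open_Int)
  moreover have "T \<subseteq> U" by (auto simp: T_def)
  ultimately have "G cb \<in> interior (G ` T)"
    using sussmann_open_mapping[OF U(1) contG U(2) dG _ g(2)] g(1) linear_conv_bounded_linear by blast
  moreover have "F cb = 0" using UM U' cb by blast
  then have "G cb = 0" by (simp add: G_def A'.zero P.zero)
  ultimately have "\<forall>\<^sub>F w in nhds 0. w \<in> G ` T"
    unfolding eventually_nhds using interior_subset open_interior by (metis subsetD)
  moreover have "((\<lambda>z. P (z - cb)) \<longlongrightarrow> P (cb - cb)) (nhds cb)"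
    using linP linear_conv_bounded_linear
    by (intro bounded_linear.tendsto[of P] tendsto_intros filterlim_ident) blast
  then have "((\<lambda>z. P (z - cb)) \<longlongrightarrow> 0) (nhds cb)"
    by (simp add: P.zero)
  ultimately have "\<forall>\<^sub>F z in nhds cb. P (z - cb) \<in> G ` T"
    by (rule eventually_compose_filterlim)
  then show ?thesis
  proof eventually_elim
    case (elim z)
    then obtain p where p: "p \<in> T" "G p = P (z - cb)" by (metis imageE)
    have eq: "?A' (F p) = P (z - p)"
      using p(2) by (simp add: G_def P.diff algebra_simps)
    \<comment> \<open>The two sides of \<open>eq\<close> lie in orthogonal subspaces, since
      \<open>P\<close> maps into the kernel of \<open>A\<close>; being equal, both vanish.\<close>
    have "P (z - p) \<bullet> ?A' (F p) = 0"
      by (simp add: adj AP)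
    then have P0': "P (z - p) = 0" "?A' (F p) = 0" by (simp_all add: eq)
    then have "F p = 0" using A'0 FV V by (auto simp: A_def)
    then have "p \<in> M" using p UM by (auto simp: T_def)
    then show ?case
      using p normal[OF P0'(1)] by (auto simp: T_def A_def dist_commute)
  qed
qed

text \<open>If the sequence stayed off \<open>M\<close>, a limiting normal direction \<open>u\<close> from \<open>M\<close> to the sequence
  could be added to \<open>vb\<close> within the subdifferential. Subgradients at nearby points of \<open>M\<close>
  converging to \<open>vb + e u\<close> then contradict monotonicity.\<close>

lemma partly_smooth_identification:
  fixes M :: "'b::euclidean_space set"
  assumes h: "convex_on UNIV h" and M: "manifold_about M cb" and ps: "partly_smooth h cb M"
    and y: "y \<longlonglongrightarrow> cb" and v: "\<And>k. v k \<in> subdiff h (y k)"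
    and vb: "v \<longlonglongrightarrow> vb" "vb \<in> rel_interior (subdiff h cb)"
  shows "\<forall>\<^sub>F k in sequentially. y k \<in> M"
proof (rule ccontr)
  assume "\<not> ?thesis"
  then have fr: "\<exists>\<^sub>F k in sequentially. y k \<notin> M"
    by (simp add: not_eventually)
  define F where "F = (SOME F. \<exists>V. defining_map M cb V F)"
  have cb: "cb \<in> M" and "\<exists>F V. defining_map M cb V F"
    using M by (auto simp: manifold_about_def)
  then obtain V where F: "defining_map M cb V F"
    unfolding F_def using someI_ex[of "\<lambda>F. \<exists>V. defining_map M cb V F"] by blast
  let ?N = "normal_space M cb"
  have N: "?N = range (adjoint (\<nabla> F cb))"
    by (simp add: normal_space_def F_def)
  have "F differentiable at cb"
    using F unfolding defining_map_def C2_near_def differentiable_def by blast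
  then have "linear (adjoint (\<nabla> F cb))"
    by (intro adjoint_linear linear_frechet_derivative)
  then have subN: "subspace ?N"
    unfolding N by (simp add: linear_subspace_image)
  have inner: "\<And>y w. (\<And>k. y k \<in> M) \<Longrightarrow> y \<longlonglongrightarrow> cb \<Longrightarrow> w \<in> subdiff h cb \<Longrightarrow>
      \<exists>v. (\<forall>\<^sub>F k in sequentially. v k \<in> subdiff h (y k)) \<and> v \<longlonglongrightarrow> w"
    using ps cb unfolding partly_smooth_def set_valued_continuous_at_within_def
    by (auto dest!: eventually_nhds_x_imp_x)
  \<comment> \<open>Indices off \<open>M\<close> recur arbitrarily late, and every late
    \<open>y k\<close> has a base point in \<open>M\<close> at normal displacement, so both can be
    had beyond any \<open>n\<close>.\<close>
  have "\<exists>k p. n \<le> k \<and> y k \<notin> M \<and> p \<in> M \<and> dist p cb < inverse (Suc n) \<and> y k - p \<in> ?N" for n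
  proof -
    have "\<forall>\<^sub>F k in sequentially. \<exists>p\<in>M. dist p cb < inverse (Suc n) \<and> y k - p \<in> ?N"
      using eventually_compose_filterlim[OF manifold_point_along_normal_space[OF F cb] y] N by simp
    then have "\<exists>\<^sub>F k in sequentially. y k \<notin> M \<and> n \<le> k \<and>
        (\<exists>p\<in>M. dist p cb < inverse (Suc n) \<and> y k - p \<in> ?N)"
      by (rule frequently_eventually_frequently[OF fr eventually_conj[OF eventually_ge_at_top]])
    then show ?thesis
      using frequently_ex by blast
  qed
  then obtain K p where K: "\<And>n. n \<le> K n" and off: "\<And>n. y (K n) \<notin> M" and pM: "\<And>n. p n \<in> M"
    and pcb: "\<And>n. dist (p n) cb < inverse (Suc n)" and pN: "\<And>n. y (K n) - p n \<in> ?N"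
    by metis
  have Klim: "filterlim K at_top sequentially"
    using K by (intro filterlim_at_top_mono[OF filterlim_ident] always_eventually) simp
  have plim: "p \<longlonglongrightarrow> cb"
    using pcb by (intro metric_LIMSEQ_I) (meson less_trans reals_Archimedean order.strict_trans2
        le_imp_inverse_le of_nat_0_less_iff of_nat_le_iff Suc_le_mono zero_less_Suc)
  \<comment> \<open>The displacement is nonzero because \<open>p n\<close> is in \<open>M\<close>
    and \<open>y (K n)\<close> is not; so \<open>u\<close> lives in the compact unit sphere of the
    normal space.\<close>
  define u where "u n = sgn (y (K n) - p n)" for n
  have ne: "y (K n) - p n \<noteq> 0" for n
    using off pM by (metis eq_iff_diff_eq_0)
  have u1: "u n \<in> sphere 0 1" for n
    using ne by (simp add: u_def norm_sgn)
  have uN: "u n \<in> ?N" for n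
    using pN subN by (simp add: u_def sgn_div_norm subspace_scale)
  have "compact (sphere (0::'b) 1 \<inter> ?N)"
    by (simp add: closed_subspace subN compact_Int_closed)
  moreover have "\<forall>n. u n \<in> sphere 0 1 \<inter> ?N"
    using u1 uN by blast
  ultimately obtain ul s where ul: "ul \<in> sphere 0 1 \<inter> ?N" and s: "strict_mono s"
    and ulim: "(u \<circ> s) \<longlonglongrightarrow> ul"
    by (meson compact_def)
  obtain e where e: "0 < e" "cball vb e \<inter> affine hull (subdiff h cb) \<subseteq> subdiff h cb"
    and vbS: "vb \<in> subdiff h cb"
    using vb(2) by (auto simp: mem_rel_interior_cball)
  \<comment> \<open>The affine hull is a translate of the normal space, so moving from
    \<open>vb\<close> along \<open>ul\<close> stays in it; relative interiority then allows a step
    of length \<open>e\<close>.\<close>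
  obtain a where a: "\<And>x. x \<in> affine hull (subdiff h cb) \<longleftrightarrow> a + x \<in> ?N"
    using ps unfolding partly_smooth_def affine_parallel_expl by blast
  have "a + vb \<in> ?N" using a vbS hull_inc by metis
  then have "(a + vb) + e *\<^sub>R ul \<in> ?N"
    using ul subN by (simp add: subspace_add subspace_scale)
  then have "vb + e *\<^sub>R ul \<in> affine hull (subdiff h cb)"
    using a by (simp add: add.assoc)
  moreover have "vb + e *\<^sub>R ul \<in> cball vb e"
    using ul e(1) by (simp add: dist_norm)
  ultimately have "vb + e *\<^sub>R ul \<in> subdiff h cb"
    using e(2) by blast
  then obtain w where w: "\<forall>\<^sub>F n in sequentially. w n \<in> subdiff h (p n)" "w \<longlonglongrightarrow> vb + e *\<^sub>R ul"
    using inner[OF pM plim] by blast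
  have slim: "filterlim s at_top sequentially"
    using s filterlim_subseq by blast
  \<comment> \<open>Monotonicity between \<open>y (K (s n))\<close> and \<open>p (s n)\<close>,
    divided by their distance, makes these terms eventually nonnegative, yet their limit is
    \<open>- e\<close>.\<close>
  have lim: "(\<lambda>n. (v (K (s n)) - w (s n)) \<bullet> u (s n)) \<longlonglongrightarrow> (vb - (vb + e *\<^sub>R ul)) \<bullet> ul"
    using ulim
    by (intro tendsto_intros filterlim_compose[OF vb(1)] filterlim_compose[OF Klim]
        filterlim_compose[OF w(2)] slim) (simp add: o_def)
  have "\<forall>\<^sub>F n in sequentially. 0 \<le> (v (K (s n)) - w (s n)) \<bullet> u (s n)"
    using eventually_compose_filterlim[OF w(1) slim]
  proof eventually_elim
    case (elim n)
    then have "0 \<le> (v (K (s n)) - w (s n)) \<bullet> (y (K (s n)) - p (s n))"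
      using subdiff_monotone v by blast
    then show ?case by (simp add: u_def sgn_div_norm)
  qed
  then have "0 \<le> (vb - (vb + e *\<^sub>R ul)) \<bullet> ul"
    using lim by (intro tendsto_lowerbound) auto
  also have "\<dots> = - e"
    using ul by (simp add: power2_norm_eq_inner[symmetric])
  finally show False using e(1) by simp
qed


section \<open>Proximal steps\<close>

text \<open>Move from \<open>d\<close> a fraction \<open>t\<close> of the way to \<open>e\<close>,
  bound \<phi> by convexity, divide by \<open>t\<close> and let \<open>t\<close> tend to 0; the
  square contributes only its derivative.\<close>

lemma local_minimizer_prox_inequality:
  fixes \<phi> :: "'a::euclidean_space \<Rightarrow> real"
  assumes \<phi>: "convex_on UNIV \<phi>"
    and min: "local_minimizer (\<lambda>e. \<phi> e + \<mu> / 2 * (norm e)\<^sup>2) d"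
  shows "\<phi> d - \<mu> * (d \<bullet> (e - d)) \<le> \<phi> e"
proof -
  define u where "u = e - d"
  let ?f = "\<lambda>e. \<phi> e + \<mu> / 2 * (norm e)\<^sup>2"
  \<comment> \<open>Convexity gives \<open>?f (d + t *\<^sub>R u) - ?f d \<le> t * ?g t\<close> for
    \<open>t\<close> in \<open>(0, 1)\<close>.\<close>
  let ?g = "\<lambda>t. \<phi> e - \<phi> d + \<mu> * (d \<bullet> u) + t * (\<mu> / 2 * (norm u)\<^sup>2)"
  have "((\<lambda>t. d + t *\<^sub>R u) \<longlongrightarrow> d) (at_right 0)"
    by (auto intro!: tendsto_eq_intros)
  with min have "\<forall>\<^sub>F t in at_right 0. ?f d \<le> ?f (d + t *\<^sub>R u)"
    unfolding local_minimizer_def by (rule eventually_compose_filterlim)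
  moreover have "\<forall>\<^sub>F t in at_right 0. t \<in> {0<..<1::real}"
    by (rule eventually_at_right_real) simp
  ultimately have "\<forall>\<^sub>F t in at_right 0. 0 \<le> ?g t"
  proof eventually_elim
    case (elim t)
    have "d + t *\<^sub>R u = (1 - t) *\<^sub>R d + t *\<^sub>R e"
      by (simp add: u_def algebra_simps)
    then have "\<phi> (d + t *\<^sub>R u) \<le> (1 - t) * \<phi> d + t * \<phi> e"
      using \<phi> elim(2) by (auto simp: convex_on_def)
    moreover have "(norm (d + t *\<^sub>R u))\<^sup>2 = (norm d)\<^sup>2 + 2 * t * (d \<bullet> u) + t\<^sup>2 * (norm u)\<^sup>2"
      by (simp only: power2_norm_eq_inner)
        (simp add: inner_add_left inner_add_right inner_commute power2_eq_square algebra_simps)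
    ultimately have "0 \<le> t * ?g t"
      using elim(1) by (simp add: algebra_simps power2_eq_square)
    then show ?case using elim(2) by (simp add: zero_le_mult_iff)
  qed
  moreover have "(?g \<longlongrightarrow> \<phi> e - \<phi> d + \<mu> * (d \<bullet> u)) (at_right 0)"
    by (auto intro!: tendsto_eq_intros)
  ultimately have "0 \<le> \<phi> e - \<phi> d + \<mu> * (d \<bullet> u)"
    by (intro tendsto_lowerbound) auto
  then show ?thesis by (simp add: u_def)
qed

lemma convex_on_linearized:
  assumes h: "convex_on UNIV h" and c: "c differentiable at x"
  shows "convex_on UNIV (linearized h c x)"
proof (rule convex_onI)
  interpret L: linear "\<nabla> c x" using c by (rule linear_frechet_derivative)
  fix t :: real and d e assume t: "0 < t" "t < 1"
  have "c x + \<nabla> c x ((1 - t) *\<^sub>R d + t *\<^sub>R e)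
      = (1 - t) *\<^sub>R (c x + \<nabla> c x d) + t *\<^sub>R (c x + \<nabla> c x e)"
    by (simp add: L.add L.diff L.scale algebra_simps)
  then show "linearized h c x ((1 - t) *\<^sub>R d + t *\<^sub>R e)
      \<le> (1 - t) * linearized h c x d + t * linearized h c x e"
    using h t unfolding linearized_def convex_on_def by auto
qed simp

text \<open>The proximal inequality at \<open>d\<close>, tested at \<open>d + e\<close>, is exactly
  what the chain rule needs for the functional - \<mu> d.\<close>

lemma prox_linearized_optimality:
  assumes h: "convex_on UNIV h" and c: "c differentiable at x"
    and min: "local_minimizer (prox_linearized h c x \<mu>) d"
  shows "\<exists>v\<in>subdiff h (c x + \<nabla> c x d). adjoint (\<nabla> c x) v = - \<mu> *\<^sub>R d"
proof (rule subgradient_chain[OF h linear_frechet_derivative[OF c]])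
  interpret L: linear "\<nabla> c x" using c by (rule linear_frechet_derivative)
  fix e
  show "h (c x + \<nabla> c x d) + - \<mu> *\<^sub>R d \<bullet> e \<le> h (c x + \<nabla> c x d + \<nabla> c x e)"
    using local_minimizer_prox_inequality[OF convex_on_linearized[OF h c]
        min[unfolded prox_linearized_def], of "d + e"]
    by (simp add: linearized_def L.add add.assoc)
qed

lemma linearized_lower_bound:
  assumes w: "w \<in> subdiff h (c x)" "norm w \<le> W" and L: "\<And>e. norm (\<nabla> c x e) \<le> B * norm e"
  shows "h (c x) - W * B * norm e \<le> linearized h c x e"
proof -
  have "\<bar>w \<bullet> \<nabla> c x e\<bar> \<le> norm w * norm (\<nabla> c x e)"
    by (rule Cauchy_Schwarz_ineq2)
  also have "\<dots> \<le> W * (B * norm e)"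
    using w(2) L[of e] by (intro mult_mono) (auto intro: order_trans[OF norm_ge_zero])
  finally have "- (W * B * norm e) \<le> w \<bullet> \<nabla> c x e" by simp
  moreover have "h (c x) + w \<bullet> \<nabla> c x e \<le> linearized h c x e"
    using w(1) unfolding subdiff_def linearized_def
    by (metis (mono_tags, lifting) add_diff_cancel_left' mem_Collect_eq)
  ultimately show ?thesis by linarith
qed

lemma prox_linearized_0:
  assumes "c differentiable at x"
  shows "prox_linearized h c x \<mu> 0 = h (c x)"
  using linear_0[OF linear_frechet_derivative[OF assms]]
  by (simp add: prox_linearized_def linearized_def)

text \<open>The linearized value can drop at most linearly in \<open>norm d\<close>, and the
  quadratic term must not exceed that drop. Large \<mu> therefore forces short steps.\<close>

lemma prox_linearized_sublevel_bound:
  assumes c: "c differentiable at x" and \<mu>: "0 < \<mu>"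
    and w: "w \<in> subdiff h (c x)" "norm w \<le> W" and L: "\<And>e. norm (\<nabla> c x e) \<le> B * norm e"
    and d: "prox_linearized h c x \<mu> d \<le> prox_linearized h c x \<mu> 0" and WB: "0 \<le> W * B"
  shows "norm d \<le> 2 * W * B / \<mu>"
proof (cases "d = 0")
  case True
  then show ?thesis using divide_nonneg_pos[OF WB \<mu>] by (simp add: mult.assoc)
next
  case False
  have "\<mu> / 2 * (norm d)\<^sup>2 \<le> W * B * norm d"
    using linearized_lower_bound[OF w L, of d] d prox_linearized_0[OF c]
    by (simp add: prox_linearized_def)
  then have "norm d * (\<mu> / 2 * norm d) \<le> norm d * (W * B)"
    by (simp add: power2_eq_square mult_ac)
  then have "\<mu> / 2 * norm d \<le> W * B"
    using False by (simp del: times_divide_eq_left)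
  then show ?thesis using \<mu> by (simp add: field_simps)
qed

text \<open>Sublevel sets of the strongly convex prox objective are bounded, so a global minimizer
  exists. In a run this excludes the case that step (2) finds nothing: every rejected trial has
  failed the acceptance test.\<close>

lemma descent_step_exists:
  fixes h :: "'b::euclidean_space \<Rightarrow> real" and c :: "'a::euclidean_space \<Rightarrow> 'b"
  assumes h: "convex_on UNIV h" and c: "c differentiable at x" and \<mu>: "0 < \<mu>"
    and nmin: "\<not> local_minimizer (prox_linearized h c x \<mu>) 0"
  shows "\<exists>d. descent_step h c x \<mu> d"
proof -
  let ?f = "prox_linearized h c x \<mu>"
  obtain w where w: "w \<in> subdiff h (c x)"
    using subdiff_nonempty[OF h] by blast
  obtain B where B: "0 < B" "\<And>e. norm (\<nabla> c x e) \<le> B * norm e"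
    using linear_bounded_pos[OF linear_frechet_derivative[OF c]] by blast
  let ?r = "2 * norm w * B / \<mu>"
  have far: "norm d \<le> ?r" if "?f d \<le> ?f 0" for d
    using prox_linearized_sublevel_bound[OF c \<mu> w order_refl B(2) that] B(1) by simp
  have r: "0 \<le> ?r" using B(1) \<mu> by (intro divide_nonneg_pos) auto
  have "continuous_on UNIV (linearized h c x)"
    by (rule convex_on_continuous[OF open_UNIV convex_on_linearized[OF h c]])
  then have "continuous_on (cball 0 ?r) (linearized h c x)"
    using continuous_on_subset by blast
  then have "continuous_on (cball 0 ?r) ?f"
    unfolding prox_linearized_def by (intro continuous_intros)
  moreover have "cball 0 ?r \<noteq> ({}::'a set)" using r by simp
  ultimately obtain d where d: "d \<in> cball 0 ?r" "\<And>e. e \<in> cball 0 ?r \<Longrightarrow> ?f d \<le> ?f e"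
    using continuous_attains_inf[of "cball 0 ?r" ?f] by auto
  have "?f d \<le> ?f 0" using r by (intro d(2)) simp
  \<comment> \<open>Outside the ball the objective exceeds its value at 0, by
    \<open>far\<close>.\<close>
  then have glob: "?f d \<le> ?f e" for e
    using d(2)[of e] far[of e] by (cases "?f e \<le> ?f 0") auto
  have "?f d \<noteq> ?f 0"
  proof
    assume "?f d = ?f 0"
    then have "local_minimizer ?f 0"
      using glob by (auto simp: local_minimizer_def)
    then show False using nmin by blast
  qed
  with \<open>?f d \<le> ?f 0\<close> have "?f d < ?f 0" by simp
  moreover have "local_minimizer ?f d"
    using glob by (simp add: local_minimizer_def)
  ultimately show ?thesis
    unfolding descent_step_def by blast
qed

section \<open>Boundedness of the prox parameters\<close>

text \<open>Viewing the derivative as a bounded linear operator gives convergence in operator norm,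
  the common source of pointwise convergence and of a uniform bound.\<close>

lemma C1_grad_blinfun:
  fixes c :: "'a::euclidean_space \<Rightarrow> 'b::euclidean_space"
  assumes "C1 c" and x: "x \<longlonglongrightarrow> z"
  shows "\<exists>f'. (\<forall>y. \<nabla> c y = blinfun_apply (f' y)) \<and> (\<lambda>k. f' (x k)) \<longlonglongrightarrow> f' z"
proof -
  obtain f' where f': "\<And>x. (c has_derivative blinfun_apply (f' x)) (at x)" "continuous_on UNIV f'"
    using assms(1) unfolding C1_def by blast
  have "isCont f' z"
    using f'(2) by (simp add: continuous_on_eq_continuous_at)
  then have "(\<lambda>k. f' (x k)) \<longlonglongrightarrow> f' z"
    using x isCont_tendsto_compose by blast
  then show ?thesis
    using frechet_derivative_at[OF f'(1), symmetric] by blast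
qed

lemma C1_grad_tendsto:
  assumes "C1 c" and "x \<longlonglongrightarrow> z"
  shows "(\<lambda>k. \<nabla> c (x k) e) \<longlonglongrightarrow> \<nabla> c z e"
proof -
  obtain f' where f': "\<forall>y. \<nabla> c y = blinfun_apply (f' y)" "(\<lambda>k. f' (x k)) \<longlonglongrightarrow> f' z"
    using C1_grad_blinfun[OF assms] by blast
  then show ?thesis
    using f'(2) by (simp add: f'(1) blinfun.tendsto)
qed

lemma C1_grad_bounded_along_sequence:
  assumes "C1 c" and "x \<longlonglongrightarrow> z"
  shows "\<exists>B>0. \<forall>k e. norm (\<nabla> c (x k) e) \<le> B * norm e"
proof -
  obtain f' where f': "\<forall>y. \<nabla> c y = blinfun_apply (f' y)" "(\<lambda>k. f' (x k)) \<longlonglongrightarrow> f' z"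
    using C1_grad_blinfun[OF assms] by blast
  obtain B where B: "0 < B" "\<And>k. norm (f' (x k)) \<le> B"
    using convergent_imp_Bseq[OF convergentI[OF f'(2)]] by (elim BseqE) blast
  have "norm (f' (x k) e) \<le> B * norm e" for k e
    using norm_blinfun[of "f' (x k)" e] B(2)[of k]
    by (meson mult_right_mono norm_ge_zero order_trans)
  then show ?thesis
    using B(1) by (auto simp: f'(1))
qed

lemma C1_differentiable: "C1 c \<Longrightarrow> c differentiable at x"
  unfolding C1_def differentiable_def by blast

text \<open>A descent step has predicted decrease above \<mu>/2 times
  \<open>(norm d)\<^sup>2\<close>. For large \<mu> the part left over by \<sigma> < 1 covers the
  projection error \<gamma> times \<open>(norm d)\<^sup>2\<close>.\<close>

lemma large_prox_parameter_accepted: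
  fixes h :: "'b::euclidean_space \<Rightarrow> real" and c :: "'a::euclidean_space \<Rightarrow> 'b"
  assumes c: "C1 c" and c2: "C2_near c z" and h: "convex_on UNIV h" and \<sigma>: "\<sigma> < 1"
    and ep: "efficient_projection h c x J \<mu> d xp" and x: "x \<longlonglongrightarrow> z"
  shows "\<exists>m>0. \<forall>\<^sub>F k in sequentially. \<forall>j\<le>J k.
    m \<le> \<mu> k j \<longrightarrow> descent_step h c (x k) (\<mu> k j) (d k j) \<longrightarrow> acceptable h c \<sigma> (x k) (d k j) (xp k j)"
proof -
  have cdiff: "c differentiable at y" for y
    using c by (rule C1_differentiable)
  obtain \<gamma> \<delta> where \<gamma>: "0 < \<gamma>" and \<delta>: "0 < \<delta>" and eff: "\<forall>k. \<forall>j\<le>J k.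
      descent_step h c (x k) (\<mu> k j) (d k j) \<and>
      x k \<in> cball z \<delta> \<and> d k j \<in> cball 0 \<delta> \<and>
      \<bar>linearized h c (x k) (d k j) - h (c z)\<bar> < \<delta> \<longrightarrow>
      norm (xp k j - (x k + d k j)) \<le> \<gamma> * (norm (d k j))\<^sup>2 \<and>
      h (c (xp k j)) \<le> linearized h c (x k) (d k j) + \<gamma> * (norm (d k j))\<^sup>2"
    using ep[unfolded efficient_projection_def, rule_format, OF c2] by blast
  obtain B where B: "0 < B" "\<forall>k e. norm (\<nabla> c (x k) e) \<le> B * norm e"
    using C1_grad_bounded_along_sequence[OF c x] by blast
  have cx: "(\<lambda>k. c (x k)) \<longlonglongrightarrow> c z"
    using isCont_tendsto_compose[OF differentiable_imp_continuous_within[OF cdiff] x] .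
  obtain W0 where "\<forall>y\<in>range (\<lambda>k. c (x k)). \<forall>w\<in>subdiff h y. norm w \<le> W0"
    using subdiff_bounded_on_bounded[OF h convergent_imp_bounded[OF cx]] by blast
  then have W0: "norm w \<le> W0" if "w \<in> subdiff h (c (x k))" for k w
    using that by blast
  define W where "W = max W0 0"
  obtain \<eta> where \<eta>: "0 < \<eta>" "\<And>y. dist y (c z) < \<eta> \<Longrightarrow> dist (h y) (h (c z)) < \<delta>"
    using convex_on_UNIV_isCont[OF h, of "c z"] \<delta> unfolding continuous_at_eps_delta by blast
  \<comment> \<open>The three bounds on the step length: \<delta> for the projection's range,
    \<eta>/(2B) to keep the linearized value within \<delta> of \<open>h (c z)\<close>, and
    1/(2\<gamma>) to turn the quadratic distance error into half the step length.\<close>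
  define \<rho> where "\<rho> = min \<delta> (min (\<eta> / (2 * B)) (1 / (2 * \<gamma>)))"
  have \<rho>: "0 < \<rho>" "\<rho> \<le> \<delta>" "B * \<rho> \<le> \<eta> / 2" "\<gamma> * \<rho> \<le> 1 / 2"
  proof -
    have "\<rho> \<le> \<eta> / (2 * B)" "\<rho> \<le> 1 / (2 * \<gamma>)" by (simp_all add: \<rho>_def)
    then show "B * \<rho> \<le> \<eta> / 2" "\<gamma> * \<rho> \<le> 1 / 2"
      using B(1) \<gamma> by (simp_all add: pos_le_divide_eq mult_ac)
    show "0 < \<rho>" "\<rho> \<le> \<delta>" using \<delta> \<eta>(1) B(1) \<gamma> by (simp_all add: \<rho>_def)
  qed
  \<comment> \<open>The first entry forces \<open>norm d \<le> \<rho>\<close>, with 1 added so that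
    \<open>m\<close> is positive even if \<open>W = 0\<close>; the second yields \<gamma> \<le> (1 -
    \<sigma>) \<mu>/2.\<close>
  define m where "m = max (2 * W * B / \<rho> + 1) (2 * \<gamma> / (1 - \<sigma>))"
  have W: "0 \<le> W" by (simp add: W_def)
  have m: "0 < m" "2 * W * B / \<rho> \<le> m" "2 * \<gamma> / (1 - \<sigma>) \<le> m"
  proof -
    have "0 \<le> 2 * W * B / \<rho>" using W B(1) \<rho>(1) by simp
    then show "0 < m" "2 * W * B / \<rho> \<le> m" "2 * \<gamma> / (1 - \<sigma>) \<le> m"
      unfolding m_def by linarith+
  qed
  have "\<forall>\<^sub>F k in sequentially. dist (x k) z < \<delta>"
    using tendstoD[OF x \<delta>] .
  moreover have "\<forall>\<^sub>F k in sequentially. dist (c (x k)) (c z) < \<eta> / 2"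
    using \<eta>(1) by (intro tendstoD[OF cx]) simp
  ultimately have "\<forall>\<^sub>F k in sequentially. \<forall>j\<le>J k. m \<le> \<mu> k j \<longrightarrow>
    descent_step h c (x k) (\<mu> k j) (d k j) \<longrightarrow> acceptable h c \<sigma> (x k) (d k j) (xp k j)"
  proof (eventually_elim, intro allI impI)
    fix k j
    assume xk: "dist (x k) z < \<delta>" and cxk: "dist (c (x k)) (c z) < \<eta> / 2" and j: "j \<le> J k"
      and mk: "m \<le> \<mu> k j" and ds: "descent_step h c (x k) (\<mu> k j) (d k j)"
    let ?d = "d k j" let ?l = "linearized h c (x k) (d k j)"
    have \<mu>: "0 < \<mu> k j" using m mk by linarith
    have less: "prox_linearized h c (x k) (\<mu> k j) ?d < prox_linearized h c (x k) (\<mu> k j) 0"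
      using ds by (simp add: descent_step_def)
    obtain w where w: "w \<in> subdiff h (c (x k))"
      using subdiff_nonempty[OF h] by blast
    have "norm w \<le> W" using W0[OF w] by (simp add: W_def)
    then have "norm ?d \<le> 2 * W * B / \<mu> k j"
      using W B less by (intro prox_linearized_sublevel_bound[OF cdiff \<mu> w]) auto
    also have "\<dots> \<le> \<rho>"
    proof -
      have "2 * W * B \<le> m * \<rho>" using m(2) \<rho>(1) by (simp add: divide_le_eq)
      also have "\<dots> \<le> \<mu> k j * \<rho>" using mk \<rho>(1) by (intro mult_right_mono) auto
      finally show ?thesis using \<mu> by (simp add: divide_le_eq mult.commute)
    qed
    finally have d\<rho>: "norm ?d \<le> \<rho>" .
    have "norm (\<nabla> c (x k) ?d) \<le> \<eta> / 2"
      using B(2)[rule_format, of k ?d] mult_left_mono[OF d\<rho>, of B] B(1) \<rho>(3) by linarith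
    then have "dist (c (x k) + \<nabla> c (x k) ?d) (c z) < \<eta>"
      using cxk norm_triangle_ineq[of "c (x k) - c z" "\<nabla> c (x k) ?d"]
      by (simp add: dist_norm algebra_simps)
    then have "\<bar>?l - h (c z)\<bar> < \<delta>"
      using \<eta>(2) by (simp add: linearized_def dist_real_def)
    moreover have "x k \<in> cball z \<delta>" using xk by (simp add: dist_commute)
    moreover have "?d \<in> cball 0 \<delta>" using d\<rho> \<rho>(2) by simp
    ultimately have E: "norm (xp k j - (x k + ?d)) \<le> \<gamma> * (norm ?d)\<^sup>2" "h (c (xp k j)) \<le> ?l + \<gamma> * (norm ?d)\<^sup>2"
      using eff j ds by blast+
    have "\<gamma> * norm ?d \<le> 1 / 2"
      using mult_left_mono[OF d\<rho>, of \<gamma>] \<gamma> \<rho>(4) by linarith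
    then have "(\<gamma> * norm ?d) * norm ?d \<le> 1 / 2 * norm ?d"
      by (rule mult_right_mono) simp
    then have near: "norm (xp k j - (x k + ?d)) \<le> 1 / 2 * norm ?d"
      using E(1) by (simp add: power2_eq_square mult.assoc)
    have dec: "\<mu> k j / 2 * (norm ?d)\<^sup>2 < h (c (x k)) - ?l"
      using less prox_linearized_0[OF cdiff] by (simp add: prox_linearized_def)
    have "\<gamma> \<le> (1 - \<sigma>) * (\<mu> k j / 2)"
    proof -
      have "2 * \<gamma> / (1 - \<sigma>) \<le> \<mu> k j" using m(3) mk by linarith
      then show ?thesis using \<sigma> by (simp add: divide_le_eq algebra_simps)
    qed
    then have "\<gamma> * (norm ?d)\<^sup>2 \<le> (1 - \<sigma>) * (\<mu> k j / 2) * (norm ?d)\<^sup>2"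
      by (rule mult_right_mono) simp
    also have "\<dots> \<le> (1 - \<sigma>) * (h (c (x k)) - ?l)"
      using dec \<sigma> by (simp only: mult.assoc) (intro mult_left_mono; simp)
    finally have "\<sigma> * (h (c (x k)) - ?l) \<le> h (c (x k)) - h (c (xp k j))"
      using E(2) by (simp add: algebra_simps)
    then show "acceptable h c \<sigma> (x k) ?d (xp k j)"
      using near by (simp add: acceptable_def)
  qed
  then show ?thesis using m(1) by blast
qed

lemma proxdescent_run_parameter_ge:
  assumes run: "proxdescent_run h c \<tau> \<sigma> \<mu>min x J \<mu> d xp" and "1 < \<tau>" "0 < \<mu>min" and j: "j \<le> J k"
  shows "\<mu>min \<le> \<mu> k j"
proof -
  have "\<mu>min \<le> \<mu> k 0"
    using run by (cases k) (auto simp: proxdescent_run_def)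
  moreover have "\<mu> k (Suc j) = \<tau> * \<mu> k j" if "j < J k" for j
    using run that by (auto simp: proxdescent_run_def)
  ultimately show ?thesis
    using j
  proof (induction j)
    case (Suc j)
    then have "\<mu>min \<le> \<mu> k j" by simp
    moreover have "1 * \<mu> k j \<le> \<tau> * \<mu> k j"
      using assms(2,3) calculation by (intro mult_right_mono) auto
    ultimately show ?case using Suc by simp
  qed simp
qed

text \<open>Late rejected trials have \<mu> below the acceptance threshold \<open>m\<close>, so one
  increase leads to less than \<tau> m, and acceptance never raises \<mu> except to the floor. Hence
  a bound persists from \<open>K\<close> on.\<close>

lemma proxdescent_run_parameter_bounded:
  fixes h :: "'b::euclidean_space \<Rightarrow> real" and c :: "'a::euclidean_space \<Rightarrow> 'b"
  assumes c: "C1 c" and c2: "C2_near c z" and h: "convex_on UNIV h"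
    and const: "1 < \<tau>" "\<sigma> < 1" "0 < \<mu>min"
    and run: "proxdescent_run h c \<tau> \<sigma> \<mu>min x J \<mu> d xp"
    and ep: "efficient_projection h c x J \<mu> d xp" and x: "x \<longlonglongrightarrow> z"
  shows "\<exists>C. \<forall>\<^sub>F k in sequentially. \<mu> k (J k) \<le> C"
proof -
  obtain m K where m: "0 < m" and acc: "\<And>k j. K \<le> k \<Longrightarrow> j \<le> J k \<Longrightarrow> m \<le> \<mu> k j \<Longrightarrow>
      descent_step h c (x k) (\<mu> k j) (d k j) \<Longrightarrow> acceptable h c \<sigma> (x k) (d k j) (xp k j)"
    using large_prox_parameter_accepted[OF c c2 h const(2) ep x]
    unfolding eventually_sequentially by metis
  have ge: "\<mu>min \<le> \<mu> k j" if "j \<le> J k" for k j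
    using proxdescent_run_parameter_ge[OF run const(1,3) that] .
  define C where "C = max (\<mu> K 0) (\<tau> * m)"
  have trial: "\<mu> k (Suc j) \<le> C" if k: "K \<le> k" and j: "j < J k" for k j
  proof -
    have pos: "0 < \<mu> k j" using ge[of j k] j const(3) by simp
    have "\<not> local_minimizer (prox_linearized h c (x k) (\<mu> k j)) 0"
      using run j by (auto simp: proxdescent_run_def)
    then have "\<exists>d. descent_step h c (x k) (\<mu> k j) d"
      using descent_step_exists[OF h C1_differentiable[OF c] pos] by blast
    moreover have "(\<nexists>d'. descent_step h c (x k) (\<mu> k j) d') \<or>
         descent_step h c (x k) (\<mu> k j) (d k j) \<and> \<not> acceptable h c \<sigma> (x k) (d k j) (xp k j)"
      and eq: "\<mu> k (Suc j) = \<tau> * \<mu> k j"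
      using run j unfolding proxdescent_run_def by blast+
    ultimately have "descent_step h c (x k) (\<mu> k j) (d k j)" "\<not> acceptable h c \<sigma> (x k) (d k j) (xp k j)"
      by blast+
    then have "\<mu> k j < m" using acc[OF k] j by (meson less_imp_le not_le)
    then show ?thesis using eq const(1) by (simp add: C_def le_max_iff_disj)
  qed
  \<comment> \<open>If \<open>J k = 0\<close>, the accepted parameter is the initial one; otherwise
    it was produced by a rejected trial.\<close>
  then have inner: "\<mu> k (J k) \<le> C" if "K \<le> k" "\<mu> k 0 \<le> C" for k
    using that by (cases "J k") auto
  have "\<mu> (K + i) 0 \<le> C" for i
  proof (induction i)
    case (Suc i)
    then have le: "\<mu> (K + i) (J (K + i)) \<le> C" using inner by simp
    have pos: "0 < \<mu> (K + i) (J (K + i))"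
      using ge[of "J (K + i)" "K + i"] const(3) by linarith
    then have "\<mu> (K + i) (J (K + i)) / \<tau> \<le> \<mu> (K + i) (J (K + i))"
      using const(1) by (simp add: divide_le_eq)
    moreover have "\<mu>min \<le> C"
      using ge[of 0 K] by (simp add: C_def le_max_iff_disj)
    moreover have "\<mu> (Suc (K + i)) 0 = max \<mu>min (\<mu> (K + i) (J (K + i)) / \<tau>)"
      using run by (auto simp: proxdescent_run_def)
    ultimately show ?case using le by simp
  qed (simp add: C_def)
  then have "\<mu> k (J k) \<le> C" if "K \<le> k" for k
    using inner that by (metis le_add_diff_inverse)
  then show ?thesis
    unfolding eventually_sequentially by blast
qed

section \<open>Convergence of the multipliers\<close>

text \<open>Otherwise a subsequence stays away from \<open>w\<close>, and by Bolzano-Weierstrass it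
  has a cluster point other than \<open>w\<close>.\<close>

lemma bounded_LIMSEQ_unique_cluster_point:
  fixes v :: "nat \<Rightarrow> 'a::heine_borel"
  assumes b: "bounded (range v)"
    and uniq: "\<And>r l. strict_mono r \<Longrightarrow> (v \<circ> r) \<longlonglongrightarrow> l \<Longrightarrow> l = w"
  shows "v \<longlonglongrightarrow> w"
proof (rule ccontr)
  assume "\<not> v \<longlonglongrightarrow> w"
  then obtain e where e: "0 < e" and "\<not> (\<forall>\<^sub>F k in sequentially. dist (v k) w < e)"
    by (auto simp: tendsto_iff)
  then have "infinite {k. \<not> dist (v k) w < e}"
    by (simp add: not_eventually frequently_cofinite[symmetric] cofinite_eq_sequentially)
  then obtain r :: "nat \<Rightarrow> nat" where r: "strict_mono r" "\<And>n. \<not> dist (v (r n)) w < e"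
    using infinite_enumerate by blast
  have "bounded (range (v \<circ> r))"
    using b by (rule bounded_subset) auto
  then obtain l s where s: "strict_mono s" "((v \<circ> r) \<circ> s) \<longlonglongrightarrow> l"
    using bounded_imp_convergent_subsequence by blast
  then have "l = w"
    using uniq[of "r \<circ> s" l] r(1) strict_mono_o by (auto simp: o_assoc)
  then have "\<forall>\<^sub>F n in sequentially. dist (v (r (s n))) w < e"
    using tendstoD[OF s(2) e] by simp
  then show False
    using r(2) eventually_happens' sequentially_bot by blast
qed

text \<open>Nonemptiness of \<open>C\<close> makes the definite description in \<open>par\<close>
  meaningful; translation then carries both points into the subspace without changing their
  difference.\<close>

lemma diff_mem_par:
  assumes "v \<in> C" "w \<in> C"
  shows "v - w \<in> par C"
proof -
  have "\<exists>!L. subspace L \<and> affine_parallel (affine hull C) L"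
    using assms by (intro affine_parallel_subspace affine_affine_hull) auto
  then have L: "subspace (par C)" "affine_parallel (affine hull C) (par C)"
    unfolding par_def using theI' by (metis (no_types, lifting))+
  then obtain a where a: "\<And>x. x \<in> affine hull C \<longleftrightarrow> a + x \<in> par C"
    unfolding affine_parallel_expl by blast
  then have "(a + v) - (a + w) \<in> par C"
    using assms L(1) by (intro subspace_diff) (auto simp: hull_inc a[symmetric])
  then show ?thesis by simp
qed

theorem theorem5p5:
  fixes h :: "'b::euclidean_space \<Rightarrow> real"
    and c :: "'a::euclidean_space \<Rightarrow> 'b"
    and xbar :: 'a
    and M :: "'b set"
    and \<tau> \<sigma> \<mu>min :: real
    and x :: "nat \<Rightarrow> 'a"
    and J :: "nat \<Rightarrow> nat"
    and \<mu> :: "nat \<Rightarrow> nat \<Rightarrow> real"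
    and d xp :: "nat \<Rightarrow> nat \<Rightarrow> 'a"
  assumes "C1 c"
    and "C2_near c xbar"
    and "par (subdiff h (c xbar)) \<inter> Null (adjoint (\<nabla> c xbar)) = {0}"
    and "rel_interior (subdiff h (c xbar)) \<inter> Null (adjoint (\<nabla> c xbar)) \<noteq> {}"
    and "convex_on UNIV h"
    and "\<exists>e>0. continuous_on (ball (c xbar) e) h"
    and "manifold_about M (c xbar)"
    and "partly_smooth h (c xbar) M"
    and "\<tau> > 1" and "0 < \<sigma>" and "\<sigma> < 1" and "\<mu>min > 0"
    and "proxdescent_run h c \<tau> \<sigma> \<mu>min x J \<mu> d xp"
    and "efficient_projection h c x J \<mu> d xp"
    and "x \<longlonglongrightarrow> xbar"
  shows "\<forall>\<^sub>F r in sequentially. c (x r) + \<nabla> c (x r) (d r (J r)) \<in> M"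
proof -
  note c = \<open>C1 c\<close> and h = \<open>convex_on UNIV h\<close> and x = \<open>x \<longlonglongrightarrow> xbar\<close>
    and run = \<open>proxdescent_run h c \<tau> \<sigma> \<mu>min x J \<mu> d xp\<close>
  have cdiff: "c differentiable at y" for y
    using c by (rule C1_differentiable)
  define D where "D r = d r (J r)" for r
  define m where "m r = \<mu> r (J r)" for r
  define y where "y r = c (x r) + \<nabla> c (x r) (D r)" for r
  have step: "descent_step h c (x r) (m r) (D r)" "norm (x (Suc r) - (x r + D r)) \<le> 1 / 2 * norm (D r)"
    for r
    using run by (auto simp: proxdescent_run_def D_def m_def acceptable_def)
  have D0: "D \<longlonglongrightarrow> 0"
  proof (rule Lim_null_comparison)
    \<comment> \<open>The projection moves the trial point by at most half the step, so at least
      half of the step shows in the move of the iterates.\<close>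
    have "norm (D r) \<le> 2 * norm (x (Suc r) - x r)" for r
      using step(2)[of r] norm_triangle_ineq2[of "D r" "x (Suc r) - x r"]
      by (simp add: norm_minus_commute algebra_simps)
    then show "\<forall>\<^sub>F r in sequentially. norm (D r) \<le> 2 * norm (x (Suc r) - x r)" by simp
    show "(\<lambda>r. 2 * norm (x (Suc r) - x r)) \<longlonglongrightarrow> 0"
      using x by (auto intro!: tendsto_eq_intros LIMSEQ_Suc)
  qed
  obtain C where C: "\<forall>\<^sub>F r in sequentially. m r \<le> C"
    using proxdescent_run_parameter_bounded[OF c assms(2) h assms(9,11,12) run assms(14) x]
    by (auto simp: m_def)
  have m0: "0 < m r" for r
    using proxdescent_run_parameter_ge[OF run assms(9,12), of "J r" r] assms(12) by (simp add: m_def)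
  have mD0: "(\<lambda>r. m r *\<^sub>R D r) \<longlonglongrightarrow> 0"
  proof (rule Lim_null_comparison)
    show "\<forall>\<^sub>F r in sequentially. norm (m r *\<^sub>R D r) \<le> C * norm (D r)"
      using C by eventually_elim (simp add: less_imp_le[OF m0] mult_right_mono)
    show "(\<lambda>r. C * norm (D r)) \<longlonglongrightarrow> 0"
      using D0 by (auto intro!: tendsto_eq_intros)
  qed
  obtain B where B: "0 < B" "\<forall>k e. norm (\<nabla> c (x k) e) \<le> B * norm e"
    using C1_grad_bounded_along_sequence[OF c x] by blast
  have "(\<lambda>r. \<nabla> c (x r) (D r)) \<longlonglongrightarrow> 0"
  proof (rule Lim_null_comparison)
    show "\<forall>\<^sub>F r in sequentially. norm (\<nabla> c (x r) (D r)) \<le> B * norm (D r)"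
      using B(2) by simp
    show "(\<lambda>r. B * norm (D r)) \<longlonglongrightarrow> 0"
      using D0 by (auto intro!: tendsto_eq_intros)
  qed
  moreover have "(\<lambda>r. c (x r)) \<longlonglongrightarrow> c xbar"
    using isCont_tendsto_compose[OF differentiable_imp_continuous_within[OF cdiff] x] .
  ultimately have y: "y \<longlonglongrightarrow> c xbar"
    unfolding y_def
    using tendsto_add[of "\<lambda>r. c (x r)" "c xbar" sequentially "\<lambda>r. \<nabla> c (x r) (D r)" 0] by simp
  have "\<exists>v\<in>subdiff h (y r). adjoint (\<nabla> c (x r)) v = - m r *\<^sub>R D r" for r
    using prox_linearized_optimality[OF h cdiff] step(1)[of r]
    unfolding y_def descent_step_def by blast
  then obtain v where v: "\<And>r. v r \<in> subdiff h (y r)"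
    and adj: "\<And>r. adjoint (\<nabla> c (x r)) (v r) = - m r *\<^sub>R D r"
    by metis
  obtain W where "\<forall>z\<in>range y. \<forall>w\<in>subdiff h z. norm w \<le> W"
    using subdiff_bounded_on_bounded[OF h convergent_imp_bounded[OF y]] by blast
  then have "norm (v r) \<le> W" for r
    using v by blast
  then have bv: "bounded (range v)"
    by (intro boundedI[of _ W]) blast
  obtain vb where vb: "vb \<in> rel_interior (subdiff h (c xbar))" "adjoint (\<nabla> c xbar) vb = 0"
    using assms(4) unfolding Null_def by blast
  have "v \<longlonglongrightarrow> vb"
  proof (rule bounded_LIMSEQ_unique_cluster_point[OF bv])
    fix r :: "nat \<Rightarrow> nat" and l assume r: "strict_mono r" "(v \<circ> r) \<longlonglongrightarrow> l"
    have l: "l \<in> subdiff h (c xbar)"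
      by (rule subdiff_limit[OF h _ LIMSEQ_subseq_LIMSEQ[OF y r(1)] r(2)]) (simp add: v)
    have linc: "linear (\<nabla> c z)" for z
      using cdiff by (rule linear_frechet_derivative)
    \<comment> \<open>The adjoint equation passes to the limit in weak form: paired with a fixed
      \<open>e\<close>, the adjoint becomes the derivative itself, whose values converge.\<close>
    have "e \<bullet> adjoint (\<nabla> c xbar) l = 0" for e
    proof -
      have "(\<lambda>k. \<nabla> c (x (r k)) e \<bullet> v (r k)) \<longlonglongrightarrow> \<nabla> c xbar e \<bullet> l"
        using LIMSEQ_subseq_LIMSEQ[OF C1_grad_tendsto[OF c x] r(1)] r(2) unfolding o_def by (rule tendsto_inner)
      moreover have "\<nabla> c (x (r k)) e \<bullet> v (r k) = - (e \<bullet> (m (r k) *\<^sub>R D (r k)))" for k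
        using adjoint_works[OF linc, of e "x (r k)" "v (r k)"] adj[of "r k"] by simp
      moreover have "(\<lambda>k. - (e \<bullet> (m (r k) *\<^sub>R D (r k)))) \<longlonglongrightarrow> - (e \<bullet> 0)"
        using LIMSEQ_subseq_LIMSEQ[OF mD0 r(1)] unfolding o_def
        by (intro tendsto_minus tendsto_inner tendsto_const)
      ultimately have "\<nabla> c xbar e \<bullet> l = - (e \<bullet> 0)"
        by (simp only: LIMSEQ_unique)
      then have "\<nabla> c xbar e \<bullet> l = 0" by simp
      then show ?thesis by (simp add: adjoint_works[OF linc])
    qed
    then have "adjoint (\<nabla> c xbar) l = 0"
      by (metis inner_eq_zero_iff)
    \<comment> \<open>Two critical multipliers differ by an element of both spaces in the constraint
      qualification, so they coincide.\<close>
    then have "l - vb \<in> Null (adjoint (\<nabla> c xbar))"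
      using vb(2) linear_diff[OF adjoint_linear[OF linc]] by (simp add: Null_def)
    moreover have "l - vb \<in> par (subdiff h (c xbar))"
      using l vb(1) rel_interior_subset by (blast intro: diff_mem_par)
    ultimately have "l - vb = 0"
      using assms(3) by blast
    then show "l = vb" by simp
  qed
  then have "\<forall>\<^sub>F r in sequentially. y r \<in> M"
    using partly_smooth_identification[OF h assms(7,8) y v _ vb(1)] by blast
  then show ?thesis
    by (simp add: y_def D_def)
qed

end
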